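(* Let $G$ and $H$ be graphs, each with no universal vertex. Then $\mathcal{R}(G\vee H)$ is isomorphic to the graph $X$ defined as follows. The vertex set of $X$ is the disjoint union of $\mathcal{M}(G)$, $\mathcal{M}(H)$ and $V(G)\times V(H)$. The edges of $X$ are: the edges of $\mathcal{R}(G)$ on $\mathcal{M}(G)$; the edges of $\mathcal{R}(H)$ on $\mathcal{M}(H)$; the edges of the Cartesian product $G\,\square\,H$ on $V(G)\times V(H)$; and, for $M\in\mathcal{M}(G)\cup\mathcal{M}(H)$ and $(u,v)\in V(G)\times V(H)$, an edge between $M$ and $(u,v)$ if and only if $M\cap\{u,v\}\neq\emptyset$. There are no other edges (in particular no edges between $\mathcal{M}(G)$ and $\mathcal{M}(H)$).
   Context: All graphs are finite, simple and undirected; $N(v)$ denotes the open neighbourhood of $v$. A set $S\subseteq V(G)$ is a dominating set if every vertex of $G$ is in $S$ or adjacent to a vertex of $S$; it is a minimal dominating set if no proper subset of $S$ is a dominating set. $\mathcal{M}(G)$ denotes the set of minimal dominating sets of $G$. The reconfiguration graph $\mathcal{R}(G)$ has vertex set $\mathcal{M}(G)$, and two minimal dominating sets $M_1,M_2$ are adjacent iff there is a vertex $v$ with either ($M_2\setminus M_1=\{v\}$ and $M_1\setminus M_2\subseteq N(v)$) or ($M_1\setminus M_2=\{v\}$ and $M_2\setminus M_1\subseteq N(v)$). A universal vertex is a vertex adjacent to all other vertices. The join $G\vee H$ is the disjoint union of $G$ and $H$ together with all edges between $V(G)$ and $V(H)$. The Cartesian product $G\,\square\,H$ has vertex set $V(G)\times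 V(H)$ with $(u,v)\sim(u',v')$ iff either $u=u'$ and $v\sim v'$ in $H$, or $v=v'$ and $u\sim u'$ in $G$. *)

theory Defs
  imports "Graph_Theory.Pair_Digraph" "Graph_Theory.Digraph_Isomorphism"
begin

text \<open>
  A finite simple undirected graph is a \<^locale>\<open>pair_graph\<close>: a finite, loop-free, symmetric
  \<^typ>\<open>'a pair_pre_digraph\<close>, each edge being represented by its two opposite arcs.
\<close>

definition neighbourhood :: "'a pair_pre_digraph \<Rightarrow> 'a \<Rightarrow> 'a set" where
  "neighbourhood G v = {u. (v, u) \<in> parcs G}"

definition universal_vertex :: "'a pair_pre_digraph \<Rightarrow> 'a \<Rightarrow> bool" where
  "universal_vertex G v \<longleftrightarrow> v \<in> pverts G \<and> (\<forall>u \<in> pverts G - {v}. (v, u) \<in> parcs G)"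

definition dominating_set :: "'a pair_pre_digraph \<Rightarrow> 'a set \<Rightarrow> bool" where
  "dominating_set G S \<longleftrightarrow>
     S \<subseteq> pverts G \<and> (\<forall>v \<in> pverts G. v \<in> S \<or> (\<exists>s \<in> S. (v, s) \<in> parcs G))"

definition minimal_dominating_set :: "'a pair_pre_digraph \<Rightarrow> 'a set \<Rightarrow> bool" where
  "minimal_dominating_set G S \<longleftrightarrow>
     dominating_set G S \<and> (\<forall>T. T \<subset> S \<longrightarrow> \<not> dominating_set G T)"

definition min_dom_sets :: "'a pair_pre_digraph \<Rightarrow> 'a set set" where
  "min_dom_sets G = {S. minimal_dominating_set G S}"

definition reconf_adj :: "'a pair_pre_digraph \<Rightarrow> 'a set \<Rightarrow> 'a set \<Rightarrow> bool" where
  "reconf_adj G M\<^sub>1 M\<^sub>2 \<longleftrightarrow>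
     (\<exists>v \<in> pverts G.
        (M\<^sub>2 - M\<^sub>1 = {v} \<and> M\<^sub>1 - M\<^sub>2 \<subseteq> neighbourhood G v) \<or>
        (M\<^sub>1 - M\<^sub>2 = {v} \<and> M\<^sub>2 - M\<^sub>1 \<subseteq> neighbourhood G v))"

definition reconf_graph :: "'a pair_pre_digraph \<Rightarrow> 'a set pair_pre_digraph" where
  "reconf_graph G = \<lparr>
     pverts = min_dom_sets G,
     parcs = {(M\<^sub>1, M\<^sub>2). M\<^sub>1 \<in> min_dom_sets G \<and> M\<^sub>2 \<in> min_dom_sets G \<and> reconf_adj G M\<^sub>1 M\<^sub>2} \<rparr>"

definition graph_join ::
  "'a pair_pre_digraph \<Rightarrow> 'b pair_pre_digraph \<Rightarrow> ('a + 'b) pair_pre_digraph" where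
  "graph_join G H = \<lparr>
     pverts = Inl ` pverts G \<union> Inr ` pverts H,
     parcs = map_prod Inl Inl ` parcs G \<union> map_prod Inr Inr ` parcs H
       \<union> (Inl ` pverts G) \<times> (Inr ` pverts H) \<union> (Inr ` pverts H) \<times> (Inl ` pverts G) \<rparr>"

definition cartesian_graph_product ::
  "'a pair_pre_digraph \<Rightarrow> 'b pair_pre_digraph \<Rightarrow> ('a \<times> 'b) pair_pre_digraph" where
  "cartesian_graph_product G H = \<lparr>
     pverts = pverts G \<times> pverts H,
     parcs = {((u, v), (u', v')).
       (u, v) \<in> pverts G \<times> pverts H \<and> (u', v') \<in> pverts G \<times> pverts H \<and>
       (u = u' \<and> (v, v') \<in> parcs H \<or> v = v' \<and> (u, u') \<in> parcs G)} \<rparr>"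

text \<open>
  Tags for the disjoint union of the minimal dominating sets of the first graph, those of the
  second graph, and the pairs of vertices.
\<close>

datatype ('a, 'b) join_vertex = InG "'a set" | InH "'b set" | InGH "'a \<times> 'b"

text \<open>
  The condition \<open>M \<inter> {u, v} \<noteq> {}\<close> is evaluated inside the disjoint union of the two vertex sets,
  that is, in the vertex type of the join.
\<close>

definition join_cross_arcs ::
  "'a pair_pre_digraph \<Rightarrow> 'b pair_pre_digraph \<Rightarrow> ('a, 'b) join_vertex rel" where
  "join_cross_arcs G H =
     {(InG M, InGH (u, v)) | M u v. M \<in> min_dom_sets G \<and> u \<in> pverts G \<and> v \<in> pverts H \<and>
        Inl ` M \<inter> {Inl u, Inr v} \<noteq> {}} \<union>
     {(InH M, InGH (u, v)) | M u v. M \<in> min_dom_sets H \<and> u \<in> pverts G \<and> v \<in> pverts H \<and>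
        Inr ` M \<inter> {Inl u, Inr v} \<noteq> {}}"

definition join_reconf_model ::
  "'a pair_pre_digraph \<Rightarrow> 'b pair_pre_digraph \<Rightarrow> ('a, 'b) join_vertex pair_pre_digraph" where
  "join_reconf_model G H = \<lparr>
     pverts = InG ` min_dom_sets G \<union> InH ` min_dom_sets H \<union> InGH ` (pverts G \<times> pverts H),
     parcs = map_prod InG InG ` parcs (reconf_graph G)
       \<union> map_prod InH InH ` parcs (reconf_graph H)
       \<union> map_prod InGH InGH ` parcs (cartesian_graph_product G H)
       \<union> join_cross_arcs G H \<union> (join_cross_arcs G H)\<inverse> \<rparr>"

lemma pair_graphI:
  assumes "finite (pverts G)" "parcs G \<subseteq> pverts G \<times> pverts G" "sym (parcs G)" "irrefl (parcs G)"
  shows "pair_graph G"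
  using assms finite_subset[OF assms(2)]
  by unfold_locales (auto simp: symmetric_def irrefl_def)

lemma pair_graphD:
  assumes "pair_graph G"
  shows "finite (pverts G)" "parcs G \<subseteq> pverts G \<times> pverts G" "sym (parcs G)" "irrefl (parcs G)"
proof -
  interpret pair_graph G by fact
  show "finite (pverts G)" by (rule pair_finite_verts)
  show "parcs G \<subseteq> pverts G \<times> pverts G" by (auto dest: in_arcsD1 in_arcsD2)
  show "sym (parcs G)" by (auto intro: symI arcs_symmetric)
  show "irrefl (parcs G)" by (auto simp: irrefl_def dest: pair_no_loops)
qed

lemma pair_graph_reconf_graph:
  assumes "pair_graph G"
  shows "pair_graph (reconf_graph G)"
proof (rule pair_graphI)
  have "min_dom_sets G \<subseteq> Pow (pverts G)"
    by (auto simp: min_dom_sets_def minimal_dominating_set_def dominating_set_def)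
  then show "finite (pverts (reconf_graph G))"
    using pair_graphD(1)[OF assms] by (auto simp: reconf_graph_def intro: finite_subset)
qed (auto simp: reconf_graph_def sym_def irrefl_def reconf_adj_def)

lemma pair_graph_graph_join:
  assumes "pair_graph G" "pair_graph H"
  shows "pair_graph (graph_join G H)"
  using pair_graphD[OF assms(1)] pair_graphD[OF assms(2)]
  by (intro pair_graphI) (auto simp: graph_join_def sym_def irrefl_def)

lemma pair_graph_cartesian_graph_product:
  assumes "pair_graph G" "pair_graph H"
  shows "pair_graph (cartesian_graph_product G H)"
  using pair_graphD[OF assms(1)] pair_graphD[OF assms(2)]
  by (intro pair_graphI) (auto simp: cartesian_graph_product_def sym_def irrefl_def)

lemma pair_graph_join_reconf_model:
  assumes "pair_graph G" "pair_graph H"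
  shows "pair_graph (join_reconf_model G H)"
proof (rule pair_graphI)
  note R = pair_graphD[OF pair_graph_reconf_graph[OF assms(1)]]
    pair_graphD[OF pair_graph_reconf_graph[OF assms(2)]]
    pair_graphD[OF pair_graph_cartesian_graph_product[OF assms]]
  have V: "pverts (reconf_graph G) = min_dom_sets G" "pverts (reconf_graph H) = min_dom_sets H"
    "pverts (cartesian_graph_product G H) = pverts G \<times> pverts H"
    by (simp_all add: reconf_graph_def cartesian_graph_product_def)
  show "finite (pverts (join_reconf_model G H))"
    using R(1,5,9) unfolding V by (simp add: join_reconf_model_def)
  show "parcs (join_reconf_model G H)
      \<subseteq> pverts (join_reconf_model G H) \<times> pverts (join_reconf_model G H)"
    using R(2,6,10) unfolding V by (auto simp: join_reconf_model_def join_cross_arcs_def)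
  have sym_map: "sym (map_prod f f ` r)" if "sym r" for f :: "'c \<Rightarrow> 'd" and r
    using that by (force simp: sym_def)
  show "sym (parcs (join_reconf_model G H))"
    using sym_map[OF R(3), of InG] sym_map[OF R(7), of InH] sym_map[OF R(11), of InGH]
    by (auto simp: join_reconf_model_def Un_assoc intro!: sym_Un sym_Un_converse)
  show "irrefl (parcs (join_reconf_model G H))"
    using R(4,8,12) by (auto simp: join_reconf_model_def join_cross_arcs_def irrefl_def)
qed

end

theory Submission
  imports Defs
begin

text \<open>
  A set that meets both sides of the join contains a pair \<open>{u, v}\<close>, which already dominates; and
  such a pair is minimal because neither side has a universal vertex. A set on one side dominates
  the join iff it dominates that side. So the minimal dominating sets of the join are those of the
  two sides together with the pairs. Those on one side have at least two elements, so one of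
  them and a set meeting the other side can be adjacent only if the latter is a pair that shares a
  vertex with it.
\<close>

text \<open>Arcs of \<open>with_proj A\<close> are pairs of vertices, so a vertex map
  \<open>f\<close> already determines the arc map \<open>map_prod f f\<close>. What remains is that
  \<open>f\<close> is bijective and both preserves and reflects adjacency.\<close>

lemma digraph_iso_with_projI:
  assumes "pair_graph A" "pair_graph B"
    and bij: "bij_betw f (pverts A) (pverts B)"
    and arcs: "\<And>x y. x \<in> pverts A \<Longrightarrow> y \<in> pverts A \<Longrightarrow> (f x, f y) \<in> parcs B \<longleftrightarrow> (x, y) \<in> parcs A"
  shows "digraph_iso (with_proj A) (with_proj B)"
proof -
  interpret A: pair_graph A by fact
  let ?h = "\<lparr>iso_verts = f, iso_arcs = map_prod f f, iso_head = snd, iso_tail = fst\<rparr>"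
  have inj: "inj_on f (pverts A)" and im: "f ` pverts A = pverts B"
    using bij by (auto simp: bij_betw_def)
  have sub: "parcs A \<subseteq> pverts A \<times> pverts A" "parcs B \<subseteq> pverts B \<times> pverts B"
    using assms(1,2) pair_graphD(2) by blast+
  have "inj_on (map_prod f f) (parcs A)"
    using inj_on_subset[OF map_prod_inj_on[OF inj inj] sub(1)] .
  then have "pre_digraph.digraph_isomorphism (with_proj A) ?h"
    using inj A.wf_digraph by (simp add: pre_digraph.digraph_isomorphism_def)
  moreover have "map_prod f f ` parcs A = parcs B"
  proof (intro equalityI subsetI)
    fix e assume "e \<in> map_prod f f ` parcs A"
    then show "e \<in> parcs B" using arcs sub(1) by auto
  next
    fix e assume e: "e \<in> parcs B"
    then obtain x y where "x \<in> pverts A" "y \<in> pverts A" "e = (f x, f y)"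
      using sub(2) unfolding im[symmetric] by auto
    with e arcs show "e \<in> map_prod f f ` parcs A" by force
  qed
  then have "with_proj B = app_iso ?h (with_proj A)"
    by (simp add: app_iso_def with_proj_def im)
  ultimately show ?thesis unfolding digraph_iso_def by blast
qed

text \<open>A dominating set is nonempty because there is a vertex to dominate, and a dominating
  singleton would be a universal vertex. Stating this with \<open>\<subseteq>\<close> excludes both
  possibilities at once.\<close>

lemma dominating_set_not_subset_singleton:
  assumes "pair_graph G" "pverts G \<noteq> {}" "\<not> (\<exists>v. universal_vertex G v)" "dominating_set G M"
  shows "\<not> M \<subseteq> {x}"
proof
  assume M: "M \<subseteq> {x}"
  moreover have "M \<noteq> {}" using assms(2,4) by (auto simp: dominating_set_def)
  ultimately have "M = {x}" by blast
  then have "universal_vertex G x"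
    using assms(4) pair_graphD(3)[OF assms(1)]
    by (auto simp: dominating_set_def universal_vertex_def dest: symD)
  with assms(3) show False by blast
qed

lemma min_dom_sets_not_subset_singleton:
  assumes "pair_graph G" "pverts G \<noteq> {}" "\<not> (\<exists>v. universal_vertex G v)" "M \<in> min_dom_sets G"
  shows "\<not> M \<subseteq> {x}"
  using dominating_set_not_subset_singleton[OF assms(1-3)] assms(4)
  by (simp add: min_dom_sets_def minimal_dominating_set_def)

lemma min_dom_sets_subset_pverts: "M \<in> min_dom_sets G \<Longrightarrow> M \<subseteq> pverts G"
  by (simp add: min_dom_sets_def minimal_dominating_set_def dominating_set_def)

section \<open>Minimal dominating sets of the join\<close>

lemma graph_join_verts_simps [simp]:
  "Inl u \<in> pverts (graph_join G H) \<longleftrightarrow> u \<in> pverts G"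
  "Inr v \<in> pverts (graph_join G H) \<longleftrightarrow> v \<in> pverts H"
  by (auto simp: graph_join_def)

lemma graph_join_arcs_simps [simp]:
  "(Inl u, Inl u') \<in> parcs (graph_join G H) \<longleftrightarrow> (u, u') \<in> parcs G"
  "(Inr v, Inr v') \<in> parcs (graph_join G H) \<longleftrightarrow> (v, v') \<in> parcs H"
  "(Inl u, Inr v) \<in> parcs (graph_join G H) \<longleftrightarrow> u \<in> pverts G \<and> v \<in> pverts H"
  "(Inr v, Inl u) \<in> parcs (graph_join G H) \<longleftrightarrow> u \<in> pverts G \<and> v \<in> pverts H"
  by (force simp: graph_join_def)+

lemma pverts_graph_join: "pverts (graph_join G H) = Inl ` pverts G \<union> Inr ` pverts H"
  by (simp add: graph_join_def)

text \<open>Any single vertex of \<open>M\<close> dominates the whole opposite side, so the join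
  only demands in addition that \<open>M\<close> be nonempty. This follows from domination in
  \<open>G\<close>, which has a vertex.\<close>

lemma dominating_set_join_Inl:
  assumes "pverts G \<noteq> {}"
  shows "dominating_set (graph_join G H) (Inl ` M) \<longleftrightarrow> dominating_set G M"
proof -
  have "\<exists>s \<in> M. s \<in> pverts G" if "dominating_set G M"
    using assms that by (fastforce simp: dominating_set_def)
  then show ?thesis
    by (auto simp: dominating_set_def pverts_graph_join ball_Un image_subset_iff)
qed

lemma dominating_set_join_Inr:
  assumes "pverts H \<noteq> {}"
  shows "dominating_set (graph_join G H) (Inr ` M) \<longleftrightarrow> dominating_set H M"
proof -
  have "\<exists>s \<in> M. s \<in> pverts H" if "dominating_set H M"
    using assms that by (fastforce simp: dominating_set_def)
  then show ?thesis
    by (auto simp: dominating_set_def pverts_graph_join ball_Un image_subset_iff)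
qed

lemma dominating_set_join_pair:
  assumes "u \<in> pverts G" "v \<in> pverts H"
  shows "dominating_set (graph_join G H) {Inl u, Inr v}"
  using assms by (auto simp: dominating_set_def pverts_graph_join)

text \<open>Subsets of an image are images of subsets, and injectivity keeps proper inclusions
  proper. Hence minimality carries over along \<open>Inl\<close> and \<open>Inr\<close> as soon as
  domination does.\<close>

lemma all_psubset_image_iff:
  assumes "inj f"
  shows "(\<forall>T. T \<subset> f ` M \<longrightarrow> P T) \<longleftrightarrow> (\<forall>T. T \<subset> M \<longrightarrow> P (f ` T))"
  using assms
  by (metis (no_types, lifting) inj_image_subset_iff psubset_eq subset_imageE inj_image_eq_iff)

lemma min_dom_sets_join_Inl:
  assumes "pverts G \<noteq> {}"
  shows "Inl ` M \<in> min_dom_sets (graph_join G H) \<longleftrightarrow> M \<in> min_dom_sets G"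
  using assms
  by (simp add: min_dom_sets_def minimal_dominating_set_def all_psubset_image_iff
      dominating_set_join_Inl)

lemma min_dom_sets_join_Inr:
  assumes "pverts H \<noteq> {}"
  shows "Inr ` M \<in> min_dom_sets (graph_join G H) \<longleftrightarrow> M \<in> min_dom_sets H"
  using assms
  by (simp add: min_dom_sets_def minimal_dominating_set_def all_psubset_image_iff
      dominating_set_join_Inr)

lemma min_dom_sets_join_pair:
  assumes G: "pair_graph G" "pverts G \<noteq> {}" "\<not> (\<exists>v. universal_vertex G v)"
    and H: "pair_graph H" "pverts H \<noteq> {}" "\<not> (\<exists>v. universal_vertex H v)"
    and "u \<in> pverts G" "v \<in> pverts H"
  shows "{Inl u, Inr v} \<in> min_dom_sets (graph_join G H)"
proof -
  have "\<not> dominating_set (graph_join G H) T" if T: "T \<subset> {Inl u, Inr v}" for T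
  proof -
    \<comment> \<open>A proper subset of the pair misses one of its two vertices, so it lies on one
      side, inside a singleton.\<close>
    consider "T \<subseteq> Inl ` {u}" | "T \<subseteq> Inr ` {v}" using T by auto
    then show ?thesis
    proof cases
      case 1
      then obtain A where "A \<subseteq> {u}" "T = Inl ` A" by (blast elim: subset_imageE)
      then show ?thesis
        using dominating_set_not_subset_singleton[OF G] dominating_set_join_Inl[OF G(2)] by blast
    next
      case 2
      then obtain A where "A \<subseteq> {v}" "T = Inr ` A" by (blast elim: subset_imageE)
      then show ?thesis
        using dominating_set_not_subset_singleton[OF H] dominating_set_join_Inr[OF H(2)] by blast
    qed
  qed
  then show ?thesis
    using dominating_set_join_pair[OF assms(7,8)]
    by (simp add: min_dom_sets_def minimal_dominating_set_def)
qed

lemma min_dom_sets_join_cases: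
  assumes "pverts G \<noteq> {}" "pverts H \<noteq> {}" "S \<in> min_dom_sets (graph_join G H)"
  obtains (left) M where "M \<in> min_dom_sets G" "S = Inl ` M"
    | (right) M where "M \<in> min_dom_sets H" "S = Inr ` M"
    | (pair) u v where "u \<in> pverts G" "v \<in> pverts H" "S = {Inl u, Inr v}"
proof -
  have S: "S \<subseteq> Inl ` pverts G \<union> Inr ` pverts H"
    using min_dom_sets_subset_pverts[OF assms(3)] by (simp add: pverts_graph_join)
  consider "S \<subseteq> range Inl" | "S \<subseteq> range Inr" | u v where "Inl u \<in> S" "Inr v \<in> S"
    by (metis obj_sumE rangeI subsetI)
  then show thesis
  proof cases
    case 1
    then obtain M where "S = Inl ` M" by (blast elim: subset_imageE)
    with assms left show thesis by (simp add: min_dom_sets_join_Inl)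
  next
    case 2
    then obtain M where "S = Inr ` M" by (blast elim: subset_imageE)
    with assms right show thesis by (simp add: min_dom_sets_join_Inr)
  next
    case 3
    then have uv: "u \<in> pverts G" "v \<in> pverts H" using S by auto
    \<comment> \<open>The pair dominates by itself, so minimality of \<open>S\<close> leaves no room
      for further vertices.\<close>
    then have "\<not> {Inl u, Inr v} \<subset> S"
      using assms(3) dominating_set_join_pair[OF uv]
      by (auto simp: min_dom_sets_def minimal_dominating_set_def)
    with 3 have "S = {Inl u, Inr v}" by blast
    with uv show thesis by (rule pair)
  qed
qed

section \<open>Adjacency of vertex sets in the join\<close>

lemma reconf_adj_sym: "reconf_adj G M N \<longleftrightarrow> reconf_adj G N M"
  by (auto simp: reconf_adj_def)

text \<open>Pulls the singleton conditions of \<open>reconf_adj\<close> back along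
  \<open>Inl\<close> and \<open>Inr\<close>; the exchanged vertex is thereby forced onto the same
  side as the sets.\<close>

lemma image_eq_singleton_iff:
  assumes "inj f"
  shows "f ` A = {y} \<longleftrightarrow> (\<exists>x. y = f x \<and> A = {x})"
proof
  assume "f ` A = {y}"
  moreover from this obtain x where "y = f x" by blast
  ultimately have "f ` A = f ` {x}" by simp
  with \<open>y = f x\<close> assms show "\<exists>x. y = f x \<and> A = {x}" by (auto simp only: inj_image_eq_iff)
qed auto

lemma reconf_adj_join_Inl:
  "reconf_adj (graph_join G H) (Inl ` M) (Inl ` N) \<longleftrightarrow> reconf_adj G M N"
  by (auto simp: reconf_adj_def neighbourhood_def image_set_diff[symmetric]
      image_eq_singleton_iff pverts_graph_join bex_Un image_subset_iff)

lemma reconf_adj_join_Inr: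
  "reconf_adj (graph_join G H) (Inr ` M) (Inr ` N) \<longleftrightarrow> reconf_adj H M N"
  by (auto simp: reconf_adj_def neighbourhood_def image_set_diff[symmetric]
      image_eq_singleton_iff pverts_graph_join bex_Un image_subset_iff)

text \<open>The two images are disjoint, so each difference is a full image, and adjacency would
  require one of them to be a singleton.\<close>

lemma not_reconf_adj_join_Inl_Inr:
  assumes "\<And>x. M \<noteq> {x}" "\<And>y. N \<noteq> {y}"
  shows "\<not> reconf_adj (graph_join G H) (Inl ` M) (Inr ` N)"
proof -
  have "Inl ` M - Inr ` N = Inl ` M" "Inr ` N - Inl ` M = Inr ` N" by auto
  then show ?thesis using assms by (auto simp: reconf_adj_def image_eq_singleton_iff)
qed

text \<open>If \<open>u\<close> is shared, the only new vertex is \<open>Inr v\<close>, which is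
  adjacent to every vertex removed. Otherwise the sets are disjoint and neither of them is a
  singleton.\<close>

lemma reconf_adj_join_Inl_pair:
  assumes "M \<subseteq> pverts G" "\<And>x. M \<noteq> {x}" "u \<in> pverts G" "v \<in> pverts H"
  shows "reconf_adj (graph_join G H) (Inl ` M) {Inl u, Inr v} \<longleftrightarrow> u \<in> M"
proof (cases "u \<in> M")
  case True
  then have "{Inl u, Inr v} - Inl ` M = {Inr v}" by auto
  moreover have "Inl ` M - {Inl u, Inr v} \<subseteq> neighbourhood (graph_join G H) (Inr v)"
    using assms by (auto simp: neighbourhood_def)
  ultimately show ?thesis using True assms(4) by (auto simp: reconf_adj_def)
next
  case False
  then have "Inl ` M - {Inl u, Inr v} = Inl ` M" "{Inl u, Inr v} - Inl ` M = {Inl u, Inr v}"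
    by auto
  with False assms(2) show ?thesis
    by (auto simp: reconf_adj_def image_eq_singleton_iff)
qed

lemma reconf_adj_join_Inr_pair:
  assumes "M \<subseteq> pverts H" "\<And>x. M \<noteq> {x}" "u \<in> pverts G" "v \<in> pverts H"
  shows "reconf_adj (graph_join G H) (Inr ` M) {Inl u, Inr v} \<longleftrightarrow> v \<in> M"
proof (cases "v \<in> M")
  case True
  then have "{Inl u, Inr v} - Inr ` M = {Inl u}" by auto
  moreover have "Inr ` M - {Inl u, Inr v} \<subseteq> neighbourhood (graph_join G H) (Inl u)"
    using assms by (auto simp: neighbourhood_def)
  ultimately show ?thesis using True assms(3) by (auto simp: reconf_adj_def)
next
  case False
  then have "Inr ` M - {Inl u, Inr v} = Inr ` M" "{Inl u, Inr v} - Inr ` M = {Inl u, Inr v}"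
    by auto
  with False assms(2) show ?thesis
    by (auto simp: reconf_adj_def image_eq_singleton_iff)
qed

text \<open>If exactly one coordinate changes, both differences are singletons on the same side, and
  the condition is an edge there. If both change, the differences have two elements; if none does,
  they are empty, matching the absence of loops.\<close>

lemma reconf_adj_join_pairs:
  assumes "pair_graph G" "pair_graph H"
    and "u \<in> pverts G" "v \<in> pverts H" "u' \<in> pverts G" "v' \<in> pverts H"
  shows "reconf_adj (graph_join G H) {Inl u, Inr v} {Inl u', Inr v'} \<longleftrightarrow>
    u = u' \<and> (v, v') \<in> parcs H \<or> v = v' \<and> (u, u') \<in> parcs G"
proof -
  have s: "(x, y) \<in> parcs G \<longleftrightarrow> (y, x) \<in> parcs G" "(x, x) \<notin> parcs G" for x y
    using pair_graphD(3,4)[OF assms(1)] by (auto simp: irrefl_def dest: symD)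
  have t: "(x, y) \<in> parcs H \<longleftrightarrow> (y, x) \<in> parcs H" "(x, x) \<notin> parcs H" for x y
    using pair_graphD(3,4)[OF assms(2)] by (auto simp: irrefl_def dest: symD)
  show ?thesis
    using assms s t
    by (cases "u = u'"; cases "v = v'")
      (auto simp: reconf_adj_def neighbourhood_def insert_Diff_if)
qed

section \<open>The isomorphism\<close>

fun join_vertex_set :: "('a, 'b) join_vertex \<Rightarrow> ('a + 'b) set" where
  "join_vertex_set (InG M) = Inl ` M"
| "join_vertex_set (InH M) = Inr ` M"
| "join_vertex_set (InGH (u, v)) = {Inl u, Inr v}"

text \<open>The only collision is between \<open>InG {}\<close> and \<open>InH {}\<close>, so
  excluding one of them suffices.\<close>

lemma inj_on_join_vertex_set:
  assumes "InG {} \<notin> X"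
  shows "inj_on join_vertex_set X"
proof (rule inj_onI)
  fix x y assume xy: "x \<in> X" "y \<in> X" and eq: "join_vertex_set x = join_vertex_set y"
  with assms have "x \<noteq> InG {}" "y \<noteq> InG {}" by auto
  with eq show "x = y"
    by (cases x rule: join_vertex_set.cases; cases y rule: join_vertex_set.cases)
      (auto simp: inj_image_eq_iff)
qed

lemma bij_betw_join_vertex_set:
  assumes G: "pair_graph G" "pverts G \<noteq> {}" "\<not> (\<exists>v. universal_vertex G v)"
    and H: "pair_graph H" "pverts H \<noteq> {}" "\<not> (\<exists>v. universal_vertex H v)"
  shows "bij_betw join_vertex_set (pverts (join_reconf_model G H))
    (pverts (reconf_graph (graph_join G H)))"
proof -
  have "{} \<notin> min_dom_sets G"
    using min_dom_sets_not_subset_singleton[OF G] by blast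
  then have "inj_on join_vertex_set (pverts (join_reconf_model G H))"
    by (intro inj_on_join_vertex_set) (auto simp: join_reconf_model_def)
  moreover have "join_vertex_set ` pverts (join_reconf_model G H) = min_dom_sets (graph_join G H)"
  proof (intro equalityI subsetI)
    fix S assume "S \<in> join_vertex_set ` pverts (join_reconf_model G H)"
    then show "S \<in> min_dom_sets (graph_join G H)"
      using min_dom_sets_join_pair[OF G H]
      by (auto simp: join_reconf_model_def min_dom_sets_join_Inl[OF G(2)]
          min_dom_sets_join_Inr[OF H(2)])
  next
    fix S assume "S \<in> min_dom_sets (graph_join G H)"
    with G(2) H(2) show "S \<in> join_vertex_set ` pverts (join_reconf_model G H)"
    proof (cases rule: min_dom_sets_join_cases)
      case (left M)
      then show ?thesis by (intro image_eqI[of _ _ "InG M"]) (simp_all add: join_reconf_model_def)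
    next
      case (right M)
      then show ?thesis by (intro image_eqI[of _ _ "InH M"]) (simp_all add: join_reconf_model_def)
    next
      case (pair u v)
      then show ?thesis
        by (intro image_eqI[of _ _ "InGH (u, v)"]) (simp_all add: join_reconf_model_def)
    qed
  qed
  ultimately show ?thesis by (simp add: bij_betw_def reconf_graph_def)
qed

lemma join_reconf_model_arcs_iff:
  assumes G: "pair_graph G" "pverts G \<noteq> {}" "\<not> (\<exists>v. universal_vertex G v)"
    and H: "pair_graph H" "pverts H \<noteq> {}" "\<not> (\<exists>v. universal_vertex H v)"
    and x: "x \<in> pverts (join_reconf_model G H)" and y: "y \<in> pverts (join_reconf_model G H)"
  shows "(x, y) \<in> parcs (join_reconf_model G H) \<longleftrightarrow>
    reconf_adj (graph_join G H) (join_vertex_set x) (join_vertex_set y)"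
proof -
  have nG: "M \<noteq> {v}" if "M \<in> min_dom_sets G" for M v
    using min_dom_sets_not_subset_singleton[OF G that] by blast
  have nH: "M \<noteq> {v}" if "M \<in> min_dom_sets H" for M v
    using min_dom_sets_not_subset_singleton[OF H that] by blast
  note adj = reconf_adj_join_Inl reconf_adj_join_Inr not_reconf_adj_join_Inl_Inr[OF nG nH]
    reconf_adj_join_Inl_pair[OF min_dom_sets_subset_pverts nG]
    reconf_adj_join_Inr_pair[OF min_dom_sets_subset_pverts nH]
    reconf_adj_join_pairs[OF G(1) H(1)]
  \<comment> \<open>All nine combinations of tags occur below, so the mixed cases are also needed
    with their arguments swapped.\<close>
  have not_adj: "\<not> reconf_adj (graph_join G H) (Inr ` N) (Inl ` M)"
    if "M \<in> min_dom_sets G" "N \<in> min_dom_sets H" for M N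
    using not_reconf_adj_join_Inl_Inr[OF nG nH] that by (simp add: reconf_adj_sym[of _ "Inr ` N"])
  note adj' = not_adj adj(4,5)[THEN trans[OF reconf_adj_sym]]
  have map: "(c, d) \<in> map_prod f f ` r \<longleftrightarrow> (\<exists>a b. c = f a \<and> d = f b \<and> (a, b) \<in> r)"
    for f :: "'x \<Rightarrow> 'y" and c d r by force
  show ?thesis
    using x y
    by (cases x rule: join_vertex_set.cases; cases y rule: join_vertex_set.cases)
      (auto simp: join_reconf_model_def join_cross_arcs_def map reconf_graph_def
        cartesian_graph_product_def adj adj')
qed

theorem theorem4:
  fixes G :: "'a pair_pre_digraph" and H :: "'b pair_pre_digraph"
  assumes "pair_graph G" and "pair_graph H"
    and "pverts G \<noteq> {}" and "pverts H \<noteq> {}"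
    and "\<not> (\<exists>v. universal_vertex G v)" and "\<not> (\<exists>v. universal_vertex H v)"
  shows "digraph_iso (with_proj (reconf_graph (graph_join G H)))
                     (with_proj (join_reconf_model G H))"
proof -
  let ?R = "reconf_graph (graph_join G H)" and ?X = "join_reconf_model G H"
  note GH = assms(1,3,5) assms(2,4,6)
  note bij = bij_betw_join_vertex_set[OF GH]
  have R: "pair_graph ?R" and X: "pair_graph ?X"
    using assms(1,2) pair_graph_graph_join pair_graph_reconf_graph pair_graph_join_reconf_model
    by blast+
  interpret X: pair_graph ?X by fact
  have "(join_vertex_set x, join_vertex_set y) \<in> parcs ?R \<longleftrightarrow> (x, y) \<in> parcs ?X"
    if "x \<in> pverts ?X" "y \<in> pverts ?X" for x y
    \<comment> \<open>The bijection supplies that both images are vertices of \<open>?R\<close>,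
      which reduces its arcs to \<open>reconf_adj\<close>.\<close>
    using join_reconf_model_arcs_iff[OF GH that] bij_betwE[OF bij] that
    by (simp add: reconf_graph_def)
  then have "digraph_iso (with_proj ?X) (with_proj ?R)"
    using digraph_iso_with_projI[OF X R bij] by blast
  \<comment> \<open>The map was built out of the model, where it is given by cases on the tag; the
    claim runs the other way.\<close>
  then show ?thesis by (rule digraph_iso_swap[OF X.wf_digraph])
qed

end
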